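(* Let $T\ge 2$, let $E$ be a finite set with $N$ elements, let $h_s:E\times E\to\mathbb{R}$ for $s=1,\dots,T-1$, and let $\pi$ be the probability distribution on $E^T$ given by $$\pi(z_1,\dots,z_T)=C^{-1}\exp\sum_{s=1}^{T-1}h_s(z_s,z_{s+1}),$$ where $C$ is the normalizing constant. Let $H_s$ be the $N\times N$ matrix with entries $H_s(u,v)=\exp h_s(u,v)$, $u,v\in E$, and let $B_T=\mathbf{1}$ be the $N$-column vector all of whose coordinates equal $1$. Then: 1. The normalizing constant is given by $$C=B_T^{\mathrm{T}}\left\{\prod_{s=1}^{T-1}H_s\right\}B_T .$$ 2. For time invariant potentials, i.e. $h_s=h$ (so $H_s=H$) for all $s=1,\dots,T-1$, the formula reduces to $C=\mathbf{1}^{\mathrm{T}}H^{T-1}\mathbf{1}$.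
   Context: Vectors and matrices are indexed by the elements of $E$, with the usual matrix products, e.g. $(HG)(u,v)=\sum_{w\in E}H(u,w)G(w,v)$ and $(HB)(u)=\sum_{v\in E}H(u,v)B(v)$. The product $\prod_{s=1}^{T-1}H_s$ is the ordered product $H_1H_2\cdots H_{T-1}$. The superscript $\mathrm{T}$ on a vector denotes transpose. The normalizing constant is $C=\sum_{(z_1,\dots,z_T)\in E^T}\exp\sum_{s=1}^{T-1}h_s(z_s,z_{s+1})$. *)

theory Defs
  imports "HOL-Analysis.Analysis" "HOL-Probability.Probability_Mass_Function"
begin

(* The state space E is the finite type 'e, with N = CARD('e).  A point of E^T is a function on
   nat with arguments 1, ..., T; PiE makes it undefined elsewhere, so that E^T is counted
   without repetition. *)
definition trajectories :: "nat \<Rightarrow> (nat \<Rightarrow> 'e) set"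
  where "trajectories T = (\<Pi>\<^sub>E s\<in>{1..T}. (UNIV :: 'e set))"

definition potential :: "(nat \<Rightarrow> 'e \<Rightarrow> 'e \<Rightarrow> real) \<Rightarrow> nat \<Rightarrow> (nat \<Rightarrow> 'e) \<Rightarrow> real"
  where "potential h T z = (\<Sum>s = 1..T - 1. h s (z s) (z (s + 1)))"

definition normalizing_constant :: "(nat \<Rightarrow> 'e::finite \<Rightarrow> 'e \<Rightarrow> real) \<Rightarrow> nat \<Rightarrow> real"
  where "normalizing_constant h T = (\<Sum>z\<in>trajectories T. exp (potential h T z))"

definition exp_matrix :: "('e \<Rightarrow> 'e \<Rightarrow> real) \<Rightarrow> real ^ 'e ^ 'e::finite"
  where "exp_matrix g = (\<chi> u v. exp (g u v))"

(* The multiplication of the type class instance for real ^ 'n ^ 'n is componentwise, so neither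
   prod_list nor the overloaded power gives the matrix product and the matrix power. *)
definition matrix_prod_list :: "(real ^ 'n ^ 'n) list \<Rightarrow> real ^ 'n ^ 'n::finite"
  where "matrix_prod_list Ms = foldr (**) Ms (mat 1)"

primrec matrix_power :: "real ^ 'n ^ 'n \<Rightarrow> nat \<Rightarrow> real ^ 'n ^ 'n::finite"
  where
    "matrix_power A 0 = mat 1"
  | "matrix_power A (Suc k) = A ** matrix_power A k"

lemma finite_trajectories: "finite (trajectories T :: (nat \<Rightarrow> 'e::finite) set)"
  unfolding trajectories_def by (intro finite_PiE) auto

lemma trajectories_nonempty: "(trajectories T :: (nat \<Rightarrow> 'e::finite) set) \<noteq> {}"
  unfolding trajectories_def by (simp add: PiE_eq_empty_iff)

lemma normalizing_constant_pos: "normalizing_constant h T > 0"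
  unfolding normalizing_constant_def
  by (intro sum_pos finite_trajectories trajectories_nonempty) simp

(* The distribution assumed in the theorem exists for every h and T. *)
lemma gibbs_distribution_exists:
  fixes h :: "nat \<Rightarrow> 'e::finite \<Rightarrow> 'e \<Rightarrow> real"
  shows "\<exists>\<pi> :: (nat \<Rightarrow> 'e) pmf. set_pmf \<pi> = trajectories T \<and>
    (\<forall>z\<in>trajectories T. pmf \<pi> z = inverse (normalizing_constant h T) * exp (potential h T z))"
proof -
  define f :: "(nat \<Rightarrow> 'e) \<Rightarrow> real" where
    "f z = (if z \<in> trajectories T
      then inverse (normalizing_constant h T) * exp (potential h T z) else 0)" for z
  note C = normalizing_constant_pos[of h T]
  have nn: "0 \<le> f z" for z
    using C by (simp add: f_def)
  have "(\<integral>\<^sup>+ z. ennreal (f z) \<partial>count_space UNIV) = (\<Sum>z\<in>trajectories T. ennreal (f z))"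
    by (intro nn_integral_count_space' finite_trajectories) (auto simp: f_def)
  also have "\<dots> = ennreal (\<Sum>z\<in>trajectories T. f z)"
    using nn by (simp add: sum_ennreal)
  also have "(\<Sum>z\<in>trajectories T. f z)
      = inverse (normalizing_constant h T) * (\<Sum>z\<in>trajectories T. exp (potential h T z))"
    by (simp add: f_def sum_distrib_left)
  also have "\<dots> = 1"
    using C by (simp add: normalizing_constant_def[symmetric])
  finally have one: "(\<integral>\<^sup>+ z. ennreal (f z) \<partial>count_space UNIV) = 1"
    by simp
  have pmf_eq: "pmf (embed_pmf f) z = f z" for z
    by (rule pmf_embed_pmf[OF nn one])
  have "set_pmf (embed_pmf f) = trajectories T"
    using C by (auto simp: set_pmf_eq pmf_eq f_def)
  then show ?thesis
    by (intro exI[of _ "embed_pmf f"]) (auto simp: pmf_eq f_def)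
qed

end

theory Submission
  imports Defs
begin

text \<open>
  The potential only couples consecutive sites, so the sum over trajectories can be carried out
  one site at a time, starting with the last one. The summand depends on \<open>z T\<close> only through
  \<open>exp (h (T - 1) (z (T - 1)) (z T))\<close>, and summing this factor over all values of
  \<open>z T\<close> gives the entry of \<open>H (T - 1) *v (\<chi> u. 1)\<close> at \<open>z (T - 1)\<close>.
  What remains is a sum over shorter trajectories whose terms carry a weight that depends on the
  last site, hence not a normalizing constant in general. The induction therefore runs over sums
  with an arbitrary weight vector \<open>w\<close> evaluated at the last site, in
  \<open>weighted_sum_over_trajectories\<close>; eliminating the last site replaces \<open>w\<close> by
  its image under the last matrix, which is how the ordered product builds up from the right. The
  normalizing constant is the case where \<open>w\<close> is the all-ones vector.
\<close>

lemma sum_trajectories_Suc: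
  fixes f :: "(nat \<Rightarrow> 'e::finite) \<Rightarrow> 'a::comm_monoid_add"
  shows "(\<Sum>z\<in>trajectories (Suc n). f z) = (\<Sum>z\<in>trajectories n. \<Sum>y\<in>UNIV. f (z(Suc n := y)))"
proof -
  let ?extend = "\<lambda>(y, z). z(Suc n := y)"
  have sites: "{1..Suc n} = insert (Suc n) {1..n}"
    by auto
  have "trajectories (Suc n) = ?extend ` (UNIV \<times> trajectories n :: ('e \<times> (nat \<Rightarrow> 'e)) set)"
    unfolding trajectories_def sites PiE_insert_eq ..
  moreover have "inj_on ?extend (UNIV \<times> trajectories n :: ('e \<times> (nat \<Rightarrow> 'e)) set)"
    using inj_combinator[of "Suc n" "{1..n}" "\<lambda>_. UNIV :: 'e set"]
    unfolding trajectories_def by simp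
  ultimately have "(\<Sum>z\<in>trajectories (Suc n). f z)
      = (\<Sum>(y, z)\<in>UNIV \<times> trajectories n. f (z(Suc n := y)))"
    by (simp add: sum.reindex case_prod_unfold)
  also have "\<dots> = (\<Sum>y\<in>UNIV. \<Sum>z\<in>trajectories n. f (z(Suc n := y)))"
    by (simp add: sum.cartesian_product)
  also have "\<dots> = (\<Sum>z\<in>trajectories n. \<Sum>y\<in>UNIV. f (z(Suc n := y)))"
    by (rule sum.swap)
  finally show ?thesis .
qed

lemma potential_extend:
  "potential h (Suc (Suc n)) (z(Suc (Suc n) := y))
    = potential h (Suc n) z + h (Suc n) (z (Suc n)) y"
  unfolding potential_def by simp

lemma matrix_prod_list_snoc: "matrix_prod_list (Ms @ [M]) = matrix_prod_list Ms ** M"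
proof (induction Ms)
  case Nil
  show ?case
    by (simp add: matrix_prod_list_def)
next
  case (Cons A Ms)
  then show ?case
    by (simp add: matrix_prod_list_def matrix_mul_assoc)
qed

lemma matrix_prod_list_replicate: "matrix_prod_list (replicate n A) = matrix_power A n"
  by (induction n) (simp_all add: matrix_prod_list_def)

text \<open>
  The weight \<open>w\<close> carries the contribution of the sites already summed out to the right of
  site \<open>Suc n\<close>. It has to be arbitrary: summing out one more site leads to the same kind
  of sum with the weight multiplied by a transfer matrix.
\<close>

lemma weighted_sum_over_trajectories:
  fixes h :: "nat \<Rightarrow> 'e::finite \<Rightarrow> 'e \<Rightarrow> real" and w :: "real ^ 'e"
  shows "(\<Sum>z\<in>trajectories (Suc n). exp (potential h (Suc n) z) * w $ z (Suc n))
    = (\<chi> u. 1) \<bullet> (matrix_prod_list (map (\<lambda>s. exp_matrix (h s)) [1..<Suc n]) *v w)"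
proof (induction n arbitrary: w)
  case 0
  have "trajectories 0 = {\<lambda>_. undefined :: 'e}"
    by (simp add: trajectories_def)
  then show ?case
    by (simp add: sum_trajectories_Suc potential_def matrix_prod_list_def inner_vec_def)
next
  case (Suc n)
  let ?M = "exp_matrix (h (Suc n))"
  let ?P = "matrix_prod_list (map (\<lambda>s. exp_matrix (h s)) [1..<Suc n])"
  have "(\<Sum>z\<in>trajectories (Suc (Suc n)). exp (potential h (Suc (Suc n)) z) * w $ z (Suc (Suc n)))
      = (\<Sum>z\<in>trajectories (Suc n). \<Sum>y\<in>UNIV.
          exp (potential h (Suc n) z) * (exp (h (Suc n) (z (Suc n)) y) * w $ y))"
    by (subst sum_trajectories_Suc) (simp add: potential_extend exp_add mult.assoc)
  also have "\<dots> = (\<Sum>z\<in>trajectories (Suc n). exp (potential h (Suc n) z) * (?M *v w) $ z (Suc n))"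
    by (simp add: matrix_vector_mult_def exp_matrix_def sum_distrib_left)
  also have "\<dots> = (\<chi> u. 1) \<bullet> (?P *v (?M *v w))"
    by (rule Suc.IH)
  also have "?P *v (?M *v w)
      = matrix_prod_list (map (\<lambda>s. exp_matrix (h s)) [1..<Suc (Suc n)]) *v w"
    by (simp add: matrix_prod_list_snoc matrix_vector_mul_assoc)
  finally show ?case .
qed

lemma normalizing_constant_eq_matrix_prod:
  fixes h :: "nat \<Rightarrow> 'e::finite \<Rightarrow> 'e \<Rightarrow> real"
  assumes "1 \<le> T"
  shows "normalizing_constant h T
    = (\<chi> u. 1) \<bullet> (matrix_prod_list (map (\<lambda>s. exp_matrix (h s)) [1..<T]) *v (\<chi> u. 1))"
  using weighted_sum_over_trajectories[of h "T - 1" "\<chi> u. 1"] assms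
  by (simp add: normalizing_constant_def)

theorem proposition1:
  fixes T :: nat
    and h :: "nat \<Rightarrow> 'e::finite \<Rightarrow> 'e \<Rightarrow> real"
    and \<pi> :: "(nat \<Rightarrow> 'e) pmf"
    and C :: real
    and H :: "nat \<Rightarrow> real ^ 'e ^ 'e"
    and B\<^sub>T :: "real ^ 'e"
  assumes "T \<ge> 2"
    and "C = normalizing_constant h T"
    and "set_pmf \<pi> \<subseteq> trajectories T"
    and "\<And>z. z \<in> trajectories T \<Longrightarrow> pmf \<pi> z = inverse C * exp (potential h T z)"
    and "\<And>s. s \<in> {1..T - 1} \<Longrightarrow> H s = exp_matrix (h s)"
    and "B\<^sub>T = (\<chi> u. 1)"
  shows "C = B\<^sub>T \<bullet> (matrix_prod_list (map H [1..<T]) *v B\<^sub>T) \<and>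
    (\<forall>g G. (\<forall>s\<in>{1..T - 1}. h s = g) \<longrightarrow> G = exp_matrix g \<longrightarrow>
      C = (\<chi> u. 1) \<bullet> (matrix_power G (T - 1) *v (\<chi> u. 1)))"
proof (intro conjI allI impI)
  have "map H [1..<T] = map (\<lambda>s. exp_matrix (h s)) [1..<T]"
    using assms(5) by auto
  then show "C = B\<^sub>T \<bullet> (matrix_prod_list (map H [1..<T]) *v B\<^sub>T)"
    unfolding assms(2,6) using normalizing_constant_eq_matrix_prod[of T h] assms(1)
    by (simp only:)
next
  fix g :: "'e \<Rightarrow> 'e \<Rightarrow> real" and G :: "real ^ 'e ^ 'e"
  assume g: "\<forall>s\<in>{1..T - 1}. h s = g" and G: "G = exp_matrix g"
  have "map (\<lambda>s. exp_matrix (h s)) [1..<T] = map (\<lambda>_. G) [1..<T]"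
    using g G by auto
  also have "\<dots> = replicate (T - 1) G"
    by (simp add: map_replicate_const)
  finally show "C = (\<chi> u. 1) \<bullet> (matrix_power G (T - 1) *v (\<chi> u. 1))"
    using normalizing_constant_eq_matrix_prod[of T h] assms(1,2)
    by (simp only: matrix_prod_list_replicate)
qed

end
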